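(* Let $\tau_n=(n_1,\dots,n_t)$ be a partition of $n$ with $t\ge2$, let $\widetilde{\mathcal{A}}=\{\widetilde A_i\}_{i=1}^m$ with $\widetilde A_i\in\mathbb{R}^{n\times n}$ (not all zero), and let $\widetilde W\in\mathbb{W}_{\tau_n}$. Let $\Gamma=\mathrm{diag}(\gamma_1I_{n_1},\dots,\gamma_tI_{n_t})$ with distinct real $\gamma_1,\dots,\gamma_t$, all $|\gamma_j|\le1$, and set $$\widetilde R_i=\widetilde W^{T}\widetilde A_i\widetilde W\Gamma-\Gamma\widetilde W^{T}\widetilde A_i\widetilde W,\quad \tilde r=\Big(\sum_{i=1}^m\|\widetilde R_i\|_F^2\Big)^{1/2},\quad g=\min_{j\ne k}|\gamma_j-\gamma_k|.$$ Then there exists $\mathcal{E}=\{E_i\}_{i=1}^m$, $E_i\in\mathbb{R}^{n\times n}$, such that $\widetilde W$ is an exact $\tau_n$-block diagonalizer of $\{\widetilde A_i+E_i\}_{i=1}^m$ and $$\frac{\|\mathcal{E}\|_F}{\|\widetilde{\mathcal{A}}\|_F}\le\frac{\|\widetilde W^{-1}\|_2^2}{\|\widetilde{\mathcal{A}}\|_F}\cdot\frac{\tilde r}{g}.$$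
   Context: All matrices are real; $\|\cdot\|_2$ is the spectral norm, $\|\cdot\|_F$ the Frobenius norm. For a matrix set $\mathcal{B}=\{B_i\}_{i=1}^m$, $\|\mathcal{B}\|_F=(\sum_{i=1}^m\|B_i\|_F^2)^{1/2}$. A partition $\tau_n=(n_1,\dots,n_t)$ of $n$ is a tuple of positive integers summing to $n$. Partition $A\in\mathbb{R}^{n\times n}$ as $[A_{jk}]$ with $A_{jk}\in\mathbb{R}^{n_j\times n_k}$; $\mathrm{Bdiag}_{\tau_n}(A)=\mathrm{diag}(A_{11},\dots,A_{tt})$, and $A$ is $\tau_n$-block diagonal if $A=\mathrm{Bdiag}_{\tau_n}(A)$. A nonsingular $W$ is a $\tau_n$-block diagonalizer of $\{B_i\}_{i=1}^m$ if every $W^{T}B_iW$ is $\tau_n$-block diagonal. $\mathbb{W}_{\tau_n}=\{W\in\mathbb{R}^{n\times n}: W\text{ nonsingular},\ \mathrm{Bdiag}_{\tau_n}(W^{T}W)=I_n\}$. *)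

theory Defs
  imports Complex_Main "Jordan_Normal_Form.Gauss_Jordan_Elimination"
begin

text \<open>Matrices are 0-indexed; families of m matrices are functions on the indices
  less than m, and a partition \<open>(n\<^sub>1, \<dots>, n\<^sub>t)\<close> is a list of length t.\<close>

definition is_partition :: "nat \<Rightarrow> nat list \<Rightarrow> bool" where
  "is_partition n \<tau> \<longleftrightarrow> (\<forall>k\<in>set \<tau>. 0 < k) \<and> sum_list \<tau> = n"

definition block_offset :: "nat list \<Rightarrow> nat \<Rightarrow> nat" where
  "block_offset \<tau> j = sum_list (take j \<tau>)"

definition mat_block :: "nat list \<Rightarrow> real mat \<Rightarrow> nat \<Rightarrow> nat \<Rightarrow> real mat" where
  "mat_block \<tau> A j k =
     mat (\<tau> ! j) (\<tau> ! k) (\<lambda>(p, q). A $$ (block_offset \<tau> j + p, block_offset \<tau> k + q))"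

definition Bdiag :: "nat list \<Rightarrow> real mat \<Rightarrow> real mat" where
  "Bdiag \<tau> A = diag_block_mat (map (\<lambda>j. mat_block \<tau> A j j) [0..<length \<tau>])"

definition block_diagonal :: "nat list \<Rightarrow> real mat \<Rightarrow> bool" where
  "block_diagonal \<tau> A \<longleftrightarrow> A = Bdiag \<tau> A"

definition block_diagonalizer ::
  "nat \<Rightarrow> nat list \<Rightarrow> nat \<Rightarrow> (nat \<Rightarrow> real mat) \<Rightarrow> real mat \<Rightarrow> bool" where
  "block_diagonalizer n \<tau> m B W \<longleftrightarrow>
     W \<in> carrier_mat n n \<and> invertible_mat W \<and>
     (\<forall>i<m. block_diagonal \<tau> (transpose_mat W * B i * W))"

definition WW :: "nat \<Rightarrow> nat list \<Rightarrow> real mat set" where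
  "WW n \<tau> = {W \<in> carrier_mat n n.
     invertible_mat W \<and> Bdiag \<tau> (transpose_mat W * W) = 1\<^sub>m n}"

definition frob_norm :: "real mat \<Rightarrow> real" where
  "frob_norm A = sqrt (\<Sum>i<dim_row A. \<Sum>j<dim_col A. (A $$ (i, j))\<^sup>2)"

definition family_frob_norm :: "nat \<Rightarrow> (nat \<Rightarrow> real mat) \<Rightarrow> real" where
  "family_frob_norm m B = sqrt (\<Sum>i<m. (frob_norm (B i))\<^sup>2)"

definition euclid_norm :: "real vec \<Rightarrow> real" where
  "euclid_norm v = sqrt (v \<bullet> v)"

text \<open>The spectral norm as the operator norm induced by the Euclidean norm. The supremum is
  over a nonempty set as soon as A has at least one column.\<close>

definition spectral_norm :: "real mat \<Rightarrow> real" where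
  "spectral_norm A =
     (SUP v \<in> {v \<in> carrier_vec (dim_col A). euclid_norm v = 1}. euclid_norm (A *\<^sub>v v))"

text \<open>Only meaningful for nonsingular A, where \<open>mat_inverse A\<close> is not \<open>None\<close>.\<close>

definition mat_inv :: "real mat \<Rightarrow> real mat" where
  "mat_inv A = the (mat_inverse A)"

definition block_scalar_mat :: "nat list \<Rightarrow> (nat \<Rightarrow> real) \<Rightarrow> real mat" where
  "block_scalar_mat \<tau> \<gamma> = diag_block_mat (map (\<lambda>j. \<gamma> j \<cdot>\<^sub>m 1\<^sub>m (\<tau> ! j)) [0..<length \<tau>])"

end

theory Submission
  imports Defs "HOL-Analysis.L2_Norm"
begin

text \<open>
  Write \<open>V = W\<^sup>-\<^sup>1\<close> and \<open>C\<^sub>i = W\<^sup>T A\<^sub>i W\<close>. Asking that \<open>W\<close> block diagonalize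
  \<open>A\<^sub>i + E\<^sub>i\<close> is asking that \<open>W\<^sup>T E\<^sub>i W\<close> cancel the off-diagonal blocks of \<open>C\<^sub>i\<close>. The
  choice that does only this is \<open>E\<^sub>i = V\<^sup>T D\<^sub>i V\<close> with \<open>D\<^sub>i = Bdiag (C\<^sub>i) - C\<^sub>i\<close>, since the
  congruence by \<open>V\<close> undoes the one by \<open>W\<close> (\<open>congruence_inverse_cancel\<close>).

  The size of \<open>E\<^sub>i\<close> is controlled by two estimates. As \<open>\<Gamma>\<close> is a diagonal matrix, forming the
  commutator \<open>R\<^sub>i = C\<^sub>i \<Gamma> - \<Gamma> C\<^sub>i\<close> multiplies each entry of \<open>C\<^sub>i\<close> in block \<open>(j, k)\<close> by
  \<open>\<gamma>\<^sub>k - \<gamma>\<^sub>j\<close>. Off the diagonal blocks this factor is at least \<open>g\<close> in absolute value, so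
  \<open>g \<parallel>D\<^sub>i\<parallel> \<le> \<parallel>R\<^sub>i\<parallel>\<close> in the Frobenius norm (\<open>frob_norm_off_diagonal_le_commutator\<close>). And a
  congruence by \<open>V\<close> enlarges the Frobenius norm by at most the factor \<open>\<parallel>V\<parallel>\<^sup>2\<close>, where \<open>\<parallel>V\<parallel>\<close> is
  the spectral norm (\<open>frob_norm_congruence_le\<close>). Combining the two and summing the squares
  over \<open>i\<close> gives the bound.
\<close>

section \<open>Entries of block diagonal matrices\<close>

text \<open>The number of the block in which position \<open>p\<close> lies, counted from 0; positions outside
  the partition get the junk value \<open>length \<tau>\<close>.\<close>

fun block_index :: "nat list \<Rightarrow> nat \<Rightarrow> nat" where
  "block_index [] p = 0"
| "block_index (k # ks) p = (if p < k then 0 else Suc (block_index ks (p - k)))"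

lemma block_offset_simps [simp]:
  "block_offset \<tau> 0 = 0"
  "block_offset (k # ks) (Suc j) = k + block_offset ks j"
  by (simp_all add: block_offset_def)

lemma block_index_less_length:
  "p < sum_list \<tau> \<Longrightarrow> block_index \<tau> p < length \<tau>"
  by (induction \<tau> p rule: block_index.induct) auto

lemma block_offset_block_index:
  "p < sum_list \<tau> \<Longrightarrow>
     block_offset \<tau> (block_index \<tau> p) \<le> p \<and>
     p - block_offset \<tau> (block_index \<tau> p) < \<tau> ! block_index \<tau> p"
proof (induction \<tau> p rule: block_index.induct)
  case (2 k ks p)
  show ?case
  proof (cases "p < k")
    case False
    then have "p - k < sum_list ks" using 2 by auto
    with 2 False show ?thesis by auto
  qed simp
qed simp

text \<open>The recursive definition of \<open>diag_block_mat\<close> peels off one block at a time, exactly as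
  \<open>block_index\<close> does. This closed form for the entries makes all later arguments entrywise.\<close>

lemma index_diag_block_mat:
  fixes Bs :: "'a::zero mat list"
  assumes "\<forall>B\<in>set Bs. square_mat B"
    and "p < sum_list (map dim_row Bs)" and "q < sum_list (map dim_row Bs)"
  defines "\<tau> \<equiv> map dim_row Bs"
  shows "diag_block_mat Bs $$ (p, q) =
    (if block_index \<tau> p = block_index \<tau> q
     then (Bs ! block_index \<tau> p) $$
            (p - block_offset \<tau> (block_index \<tau> p), q - block_offset \<tau> (block_index \<tau> q))
     else 0)"
  using assms(1-3) unfolding \<tau>_def
proof (induction Bs arbitrary: p q)
  case (Cons B Bs)
  have "map dim_col Bs = map dim_row Bs" using Cons.prems(1) by simp
  then have dims: "dim_row (diag_block_mat Bs) = sum_list (map dim_row Bs)"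
    "dim_col (diag_block_mat Bs) = sum_list (map dim_row Bs)" "dim_col B = dim_row B"
    using Cons.prems(1) by (simp_all add: dim_diag_block_mat del: map_eq_conv)
  show ?case
  proof (cases "p < dim_row B \<or> q < dim_row B")
    case True
    then show ?thesis using Cons.prems by (auto simp: Let_def dims)
  next
    case False
    then have "p - dim_row B < sum_list (map dim_row Bs)" "q - dim_row B < sum_list (map dim_row Bs)"
      using Cons.prems by auto
    then show ?thesis using False Cons.prems Cons.IH[of "p - dim_row B" "q - dim_row B"]
      by (simp add: Let_def dims)
  qed
qed simp

lemma Bdiag_carrier: "Bdiag \<tau> A \<in> carrier_mat (sum_list \<tau>) (sum_list \<tau>)"
  by (rule carrier_matI) (simp_all add: Bdiag_def dim_diag_block_mat mat_block_def o_def map_nth)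

lemma index_Bdiag:
  assumes "p < sum_list \<tau>" and "q < sum_list \<tau>"
  shows "Bdiag \<tau> A $$ (p, q) =
    (if block_index \<tau> p = block_index \<tau> q then A $$ (p, q) else 0)"
proof -
  have "map dim_row (map (\<lambda>j. mat_block \<tau> A j j) [0..<length \<tau>]) = \<tau>"
    by (simp add: mat_block_def o_def map_nth)
  then show ?thesis
    using index_diag_block_mat[of "map (\<lambda>j. mat_block \<tau> A j j) [0..<length \<tau>]" p q] assms
      block_index_less_length[of p \<tau>] block_offset_block_index[of p \<tau>]
      block_offset_block_index[of q \<tau>]
    by (auto simp: Bdiag_def mat_block_def)
qed

lemma block_diagonal_Bdiag: "block_diagonal \<tau> (Bdiag \<tau> A)"
  unfolding block_diagonal_def
  using Bdiag_carrier[of \<tau> A] Bdiag_carrier[of \<tau> "Bdiag \<tau> A"]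
  by (intro eq_matI) (auto simp: index_Bdiag)

lemma block_scalar_mat_carrier:
  "block_scalar_mat \<tau> \<gamma> \<in> carrier_mat (sum_list \<tau>) (sum_list \<tau>)"
  by (rule carrier_matI) (simp_all add: block_scalar_mat_def dim_diag_block_mat o_def map_nth)

lemma block_scalar_mat_eq_mat:
  "block_scalar_mat \<tau> \<gamma> =
     mat (sum_list \<tau>) (sum_list \<tau>) (\<lambda>(p, q). if p = q then \<gamma> (block_index \<tau> p) else 0)"
proof (rule eq_matI)
  fix p q
  assume "p < dim_row (mat (sum_list \<tau>) (sum_list \<tau>)
      (\<lambda>(p, q). if p = q then \<gamma> (block_index \<tau> p) else 0))"
    and "q < dim_col (mat (sum_list \<tau>) (sum_list \<tau>)
      (\<lambda>(p, q). if p = q then \<gamma> (block_index \<tau> p) else 0))"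
  then have pq: "p < sum_list \<tau>" "q < sum_list \<tau>" by auto
  have "map dim_row (map (\<lambda>j. \<gamma> j \<cdot>\<^sub>m 1\<^sub>m (\<tau> ! j)) [0..<length \<tau>]) = \<tau>"
    by (simp add: o_def map_nth)
  moreover have "p - block_offset \<tau> (block_index \<tau> p) = q - block_offset \<tau> (block_index \<tau> q)
      \<longleftrightarrow> p = q" if "block_index \<tau> p = block_index \<tau> q"
    using that block_offset_block_index[OF pq(1)] block_offset_block_index[OF pq(2)] by auto
  ultimately have "block_scalar_mat \<tau> \<gamma> $$ (p, q) = (if p = q then \<gamma> (block_index \<tau> p) else 0)"
    using index_diag_block_mat[of "map (\<lambda>j. \<gamma> j \<cdot>\<^sub>m 1\<^sub>m (\<tau> ! j)) [0..<length \<tau>]" p q] pq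
      block_index_less_length[of p \<tau>] block_offset_block_index[OF pq(1)]
      block_offset_block_index[OF pq(2)]
    by (auto simp: block_scalar_mat_def)
  then show "block_scalar_mat \<tau> \<gamma> $$ (p, q) = mat (sum_list \<tau>) (sum_list \<tau>)
      (\<lambda>(p, q). if p = q then \<gamma> (block_index \<tau> p) else 0) $$ (p, q)"
    using pq by simp
qed (use block_scalar_mat_carrier[of \<tau> \<gamma>] in auto)

text \<open>Multiplying by a diagonal matrix on the right scales columns and on the left scales rows,
  so the commutator scales each entry by a difference of two diagonal values. In particular it
  sees only the off-diagonal blocks.\<close>

lemma index_commutator_block_scalar_mat:
  assumes C: "C \<in> carrier_mat (sum_list \<tau>) (sum_list \<tau>)"
    and pq: "p < sum_list \<tau>" "q < sum_list \<tau>"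
  shows "(C * block_scalar_mat \<tau> \<gamma> - block_scalar_mat \<tau> \<gamma> * C) $$ (p, q) =
    C $$ (p, q) * (\<gamma> (block_index \<tau> q) - \<gamma> (block_index \<tau> p))"
proof -
  let ?n = "sum_list \<tau>" and ?d = "\<lambda>p. \<gamma> (block_index \<tau> p)"
  have "(C * block_scalar_mat \<tau> \<gamma>) $$ (p, q)
      = (\<Sum>k = 0..<?n. C $$ (p, k) * (if k = q then ?d k else 0))"
    using C pq by (simp add: block_scalar_mat_eq_mat scalar_prod_def)
  also have "\<dots> = (\<Sum>k = 0..<?n. if k = q then C $$ (p, k) * ?d k else 0)"
    by (rule sum.cong) auto
  also have "\<dots> = C $$ (p, q) * ?d q" using pq by simp
  finally have right: "(C * block_scalar_mat \<tau> \<gamma>) $$ (p, q) = C $$ (p, q) * ?d q" .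
  have "(block_scalar_mat \<tau> \<gamma> * C) $$ (p, q)
      = (\<Sum>k = 0..<?n. (if p = k then ?d p else 0) * C $$ (k, q))"
    using C pq by (simp add: block_scalar_mat_eq_mat scalar_prod_def)
  also have "\<dots> = (\<Sum>k = 0..<?n. if p = k then ?d p * C $$ (k, q) else 0)"
    by (rule sum.cong) auto
  also have "\<dots> = ?d p * C $$ (p, q)" using pq by simp
  finally have "(block_scalar_mat \<tau> \<gamma> * C) $$ (p, q) = ?d p * C $$ (p, q)" .
  with right show ?thesis
    using C pq block_scalar_mat_carrier[of \<tau> \<gamma>] by (simp add: algebra_simps)
qed

section \<open>Euclidean and spectral norms\<close>

lemma euclid_norm_square: "(euclid_norm v)\<^sup>2 = (\<Sum>i<dim_vec v. (v $ i)\<^sup>2)"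
proof -
  have "v \<bullet> v = (\<Sum>i<dim_vec v. (v $ i)\<^sup>2)"
    by (simp add: scalar_prod_def power2_eq_square atLeast0LessThan)
  then show ?thesis by (simp add: euclid_norm_def sum_nonneg)
qed

lemma euclid_norm_eq_L2_set: "euclid_norm v = L2_set (\<lambda>i. v $ i) {..<dim_vec v}"
  by (simp add: euclid_norm_def L2_set_def scalar_prod_def power2_eq_square atLeast0LessThan)

lemma euclid_norm_nonneg: "0 \<le> euclid_norm v"
  by (simp add: euclid_norm_eq_L2_set)

lemma abs_scalar_prod_le_euclid_norm:
  fixes v w :: "real vec"
  assumes "v \<in> carrier_vec n" and "w \<in> carrier_vec n"
  shows "\<bar>v \<bullet> w\<bar> \<le> euclid_norm v * euclid_norm w"
proof -
  have "\<bar>v \<bullet> w\<bar> \<le> (\<Sum>i<n. \<bar>v $ i\<bar> * \<bar>w $ i\<bar>)"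
    using assms sum_abs[of "\<lambda>i. v $ i * w $ i" "{..<n}"]
    by (simp add: scalar_prod_def abs_mult atLeast0LessThan)
  also have "\<dots> \<le> euclid_norm v * euclid_norm w"
    using assms L2_set_mult_ineq[of "\<lambda>i. v $ i" "\<lambda>i. w $ i" "{..<n}"]
    by (simp add: euclid_norm_eq_L2_set)
  finally show ?thesis .
qed

lemma euclid_norm_smult: "euclid_norm (c \<cdot>\<^sub>v v) = \<bar>c\<bar> * euclid_norm v"
  by (rule power2_eq_imp_eq)
    (simp_all add: euclid_norm_square power_mult_distrib sum_distrib_left euclid_norm_nonneg)

text \<open>Without boundedness the supremum in \<open>spectral_norm\<close> would carry no information. By
  Cauchy-Schwarz on each row, the Frobenius norm is an upper bound.\<close>

lemma bdd_above_spectral_norm: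
  "bdd_above ((\<lambda>v. euclid_norm (A *\<^sub>v v)) ` {v \<in> carrier_vec (dim_col A). euclid_norm v = 1})"
proof (rule bdd_aboveI2)
  fix v assume v: "v \<in> {v \<in> carrier_vec (dim_col A). euclid_norm v = 1}"
  have row: "(row A i \<bullet> v)\<^sup>2 \<le> (euclid_norm (row A i))\<^sup>2" for i
    using v abs_scalar_prod_le_euclid_norm[of "row A i" "dim_col A" v]
    by (auto simp: abs_le_square_iff[symmetric] euclid_norm_nonneg)
  have "(euclid_norm (A *\<^sub>v v))\<^sup>2 \<le> (\<Sum>i<dim_row A. (euclid_norm (row A i))\<^sup>2)"
    by (auto simp: euclid_norm_square[of "A *\<^sub>v v"] intro!: sum_mono row)
  then show "euclid_norm (A *\<^sub>v v) \<le> sqrt (\<Sum>i<dim_row A. (euclid_norm (row A i))\<^sup>2)"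
    by (rule real_le_rsqrt)
qed

lemma euclid_norm_mult_mat_vec_le:
  assumes A: "A \<in> carrier_mat nr nc" and v: "v \<in> carrier_vec nc"
  shows "euclid_norm (A *\<^sub>v v) \<le> spectral_norm A * euclid_norm v"
proof (cases "euclid_norm v = 0")
  \<comment> \<open>A vector of norm 0 cannot be normalized. This case also covers \<open>nc = 0\<close>, where there are no
    unit vectors and the supremum is unspecified.\<close>
  case True
  have "euclid_norm (A *\<^sub>v v) = 0"
  proof -
    have "row A i \<bullet> v = 0" if "i < nr" for i
      using abs_scalar_prod_le_euclid_norm[of "row A i" nc v] A v that True by auto
    then have "(euclid_norm (A *\<^sub>v v))\<^sup>2 = 0"
      using A by (simp add: euclid_norm_square)
    then show ?thesis by simp
  qed
  with True show ?thesis by simp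
next
  case False
  let ?c = "euclid_norm v"
  have pos: "?c > 0" using False euclid_norm_nonneg[of v] by simp
  let ?u = "(1 / ?c) \<cdot>\<^sub>v v"
  have "?u \<in> {v \<in> carrier_vec (dim_col A). euclid_norm v = 1}"
    using A v pos by (auto simp: euclid_norm_smult)
  then have "euclid_norm (A *\<^sub>v ?u) \<le> spectral_norm A"
    unfolding spectral_norm_def by (rule cSUP_upper[OF _ bdd_above_spectral_norm])
  moreover have "A *\<^sub>v ?u = (1 / ?c) \<cdot>\<^sub>v (A *\<^sub>v v)"
    using A v by (simp add: mult_mat_vec)
  ultimately show ?thesis using pos by (simp add: euclid_norm_smult field_simps)
qed

text \<open>A matrix and its transpose have the same spectral norm. The inequality needed here comes
  from \<open>\<parallel>A\<^sup>T v\<parallel>\<^sup>2 = v \<bullet> A (A\<^sup>T v) \<le> \<parallel>v\<parallel> \<parallel>A\<parallel> \<parallel>A\<^sup>T v\<parallel>\<close> after dividing by \<open>\<parallel>A\<^sup>T v\<parallel>\<close>. It is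
  stated for squares because the spectral norm of a matrix without columns has no known sign.\<close>

lemma euclid_norm_transpose_mult_mat_vec_le:
  assumes A: "A \<in> carrier_mat nr nc" and v: "v \<in> carrier_vec nr"
  shows "(euclid_norm (transpose_mat A *\<^sub>v v))\<^sup>2 \<le> (spectral_norm A)\<^sup>2 * (euclid_norm v)\<^sup>2"
proof -
  let ?w = "transpose_mat A *\<^sub>v v"
  have w: "?w \<in> carrier_vec nc" and Aw: "A *\<^sub>v ?w \<in> carrier_vec nr" using A v by auto
  have "(euclid_norm ?w)\<^sup>2 = v \<bullet> (A *\<^sub>v ?w)"
    using transpose_vec_mult_scalar[OF A w v] euclid_norm_nonneg[of ?w]
    by (simp add: euclid_norm_def scalar_prod_def sum_nonneg)
  also have "\<dots> \<le> euclid_norm v * euclid_norm (A *\<^sub>v ?w)"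
    using abs_scalar_prod_le_euclid_norm[OF v Aw] by simp
  also have "\<dots> \<le> euclid_norm v * (spectral_norm A * euclid_norm ?w)"
    by (intro mult_left_mono euclid_norm_mult_mat_vec_le[OF A w] euclid_norm_nonneg)
  finally have sq: "(euclid_norm ?w)\<^sup>2 \<le> (euclid_norm v * spectral_norm A) * euclid_norm ?w"
    by (simp add: mult.assoc)
  show ?thesis
  proof (cases "euclid_norm ?w = 0")
    case False
    then have "euclid_norm ?w \<le> euclid_norm v * spectral_norm A"
      using sq euclid_norm_nonneg[of ?w] by (simp add: power2_eq_square)
    then show ?thesis
      using power_mono[of "euclid_norm ?w" "euclid_norm v * spectral_norm A" 2] euclid_norm_nonneg[of ?w]
      by (simp add: power_mult_distrib mult.commute)
  qed simp
qed

section \<open>Frobenius norms\<close>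

lemma frob_norm_square:
  "(frob_norm A)\<^sup>2 = (\<Sum>i<dim_row A. \<Sum>j<dim_col A. (A $$ (i, j))\<^sup>2)"
  by (simp add: frob_norm_def sum_nonneg)

lemma frob_norm_square_col:
  "(frob_norm A)\<^sup>2 = (\<Sum>j<dim_col A. (euclid_norm (col A j))\<^sup>2)"
  unfolding frob_norm_square by (subst sum.swap) (simp add: euclid_norm_square)

lemma frob_norm_transpose: "frob_norm (transpose_mat A) = frob_norm A"
  unfolding frob_norm_def by (subst sum.swap) simp

text \<open>The squared Frobenius norm is the sum of the squared norms of the columns, and the columns
  of a product are the images of the columns of the right factor.\<close>

lemma frob_norm_transpose_mult_le:
  assumes V: "V \<in> carrier_mat nr nc" and M: "M \<in> carrier_mat nr k"
  shows "(frob_norm (transpose_mat V * M))\<^sup>2 \<le> (spectral_norm V)\<^sup>2 * (frob_norm M)\<^sup>2"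
proof -
  have "col (transpose_mat V * M) j = transpose_mat V *\<^sub>v col M j" if "j < k" for j
    using V M that by (intro eq_vecI) auto
  then show ?thesis
    using V M unfolding frob_norm_square_col sum_distrib_left
    by (auto intro!: sum_mono euclid_norm_transpose_mult_mat_vec_le[OF V])
qed

text \<open>The left factor is handled by the previous lemma. The right one becomes a left factor
  \<open>V\<^sup>T\<close> after transposing, which preserves the Frobenius norm; so the bound for \<open>V\<^sup>T\<close> serves
  for both.\<close>

lemma frob_norm_congruence_le:
  assumes V: "V \<in> carrier_mat n n" and M: "M \<in> carrier_mat n n"
  shows "(frob_norm (transpose_mat V * M * V))\<^sup>2 \<le> (spectral_norm V)\<^sup>2 * ((spectral_norm V)\<^sup>2 * (frob_norm M)\<^sup>2)"
proof -
  have "(frob_norm (transpose_mat V * M * V))\<^sup>2 = (frob_norm (transpose_mat V * (M * V)))\<^sup>2"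
    using V M by (simp add: assoc_mult_mat[of _ n n _ n _ n])
  also have "\<dots> \<le> (spectral_norm V)\<^sup>2 * (frob_norm (M * V))\<^sup>2"
    using V M by (intro frob_norm_transpose_mult_le) auto
  also have "frob_norm (M * V) = frob_norm (transpose_mat V * transpose_mat M)"
    using V M by (simp add: transpose_mult[symmetric] frob_norm_transpose)
  also have "(spectral_norm V)\<^sup>2 * (frob_norm (transpose_mat V * transpose_mat M))\<^sup>2
      \<le> (spectral_norm V)\<^sup>2 * ((spectral_norm V)\<^sup>2 * (frob_norm (transpose_mat M))\<^sup>2)"
    using V M by (intro mult_left_mono frob_norm_transpose_mult_le) auto
  finally show ?thesis by (simp add: frob_norm_transpose)
qed

section \<open>The off-diagonal part and the perturbation\<close>

text \<open>Entrywise comparison: inside the diagonal blocks the left-hand matrix vanishes, and outside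
  them the commutator scales the entry by a factor of absolute value at least \<open>g\<close>.\<close>

lemma frob_norm_off_diagonal_le_commutator:
  assumes C: "C \<in> carrier_mat (sum_list \<tau>) (sum_list \<tau>)" and "0 \<le> g"
    and gap: "\<And>j k. j < length \<tau> \<Longrightarrow> k < length \<tau> \<Longrightarrow> j \<noteq> k \<Longrightarrow> g \<le> \<bar>\<gamma> j - \<gamma> k\<bar>"
  shows "g\<^sup>2 * (frob_norm (Bdiag \<tau> C - C))\<^sup>2
    \<le> (frob_norm (C * block_scalar_mat \<tau> \<gamma> - block_scalar_mat \<tau> \<gamma> * C))\<^sup>2"
proof -
  let ?n = "sum_list \<tau>"
  let ?R = "C * block_scalar_mat \<tau> \<gamma> - block_scalar_mat \<tau> \<gamma> * C"
  have entry: "g\<^sup>2 * ((Bdiag \<tau> C - C) $$ (p, q))\<^sup>2 \<le> (?R $$ (p, q))\<^sup>2"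
    if pq: "p < ?n" "q < ?n" for p q
  proof (cases "block_index \<tau> p = block_index \<tau> q")
    case True
    then show ?thesis using C pq by (simp add: index_Bdiag)
  next
    case False
    then have "g \<le> \<bar>\<gamma> (block_index \<tau> q) - \<gamma> (block_index \<tau> p)\<bar>"
      using pq by (intro gap block_index_less_length) auto
    then have "g\<^sup>2 \<le> (\<gamma> (block_index \<tau> q) - \<gamma> (block_index \<tau> p))\<^sup>2"
      using \<open>0 \<le> g\<close> power_mono[of g _ 2] by fastforce
    then have "g\<^sup>2 * (C $$ (p, q))\<^sup>2
        \<le> (\<gamma> (block_index \<tau> q) - \<gamma> (block_index \<tau> p))\<^sup>2 * (C $$ (p, q))\<^sup>2"
      by (rule mult_right_mono) simp
    then show ?thesis
      using False C pq
      by (simp add: index_Bdiag index_commutator_block_scalar_mat power_mult_distrib mult.commute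
          del: index_minus_mat(1)) (simp add: index_Bdiag)
  qed
  show ?thesis
    using C block_scalar_mat_carrier[of \<tau> \<gamma>]
    unfolding frob_norm_square sum_distrib_left
    by (auto simp del: index_minus_mat(1) intro!: sum_mono entry)
qed

text \<open>This connects the two notions of inverse: \<open>invertible_mat\<close> gives a two-sided inverse, which
  makes \<open>W\<close> a unit of the matrix ring, and for units Gauss-Jordan elimination succeeds.\<close>

lemma mat_inv_invertible:
  assumes W: "W \<in> carrier_mat n n" and "invertible_mat W"
  shows "mat_inv W \<in> carrier_mat n n" and "W * mat_inv W = 1\<^sub>m n" and "mat_inv W * W = 1\<^sub>m n"
proof -
  obtain B where B: "inverts_mat W B" "inverts_mat B W"
    using assms(2) by (auto simp: invertible_mat_def)
  have "W * B = 1\<^sub>m n" "B * W = 1\<^sub>m (dim_row B)" using B W by (simp_all add: inverts_mat_def)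
  moreover from this have "dim_col B = n" "dim_row B = n"
    using W by (metis index_mult_mat(3) index_one_mat(3), metis W carrier_matD(2) index_mult_mat(3) index_one_mat(3))
  ultimately have "W \<in> Units (ring_mat TYPE(real) n ())"
    using W by (auto simp: Units_def ring_mat_def intro!: bexI[of _ B])
  then obtain V where "mat_inverse W = Some V"
    using mat_inverse(1)[OF W, of "()"] by (cases "mat_inverse W") auto
  then show "mat_inv W \<in> carrier_mat n n" and "W * mat_inv W = 1\<^sub>m n" and "mat_inv W * W = 1\<^sub>m n"
    using mat_inverse(2)[OF W] by (auto simp: mat_inv_def)
qed

lemma congruence_inverse_cancel:
  fixes W V D :: "real mat"
  assumes W: "W \<in> carrier_mat n n" and V: "V \<in> carrier_mat n n" and D: "D \<in> carrier_mat n n"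
    and VW: "V * W = 1\<^sub>m n"
  shows "transpose_mat W * (transpose_mat V * D * V) * W = D"
proof -
  have WV: "transpose_mat W * transpose_mat V = 1\<^sub>m n"
    using transpose_mult[OF V W] VW by simp
  have "transpose_mat W * (transpose_mat V * D * V) * W
      = (transpose_mat W * transpose_mat V) * D * (V * W)"
    using W V D by (simp add: assoc_mult_mat[of _ n n _ n _ n])
  then show ?thesis using WV VW D by simp
qed

theorem proposition3p2:
  fixes n m :: nat and \<tau> :: "nat list"
    and A R :: "nat \<Rightarrow> real mat" and W \<Gamma> :: "real mat"
    and \<gamma> :: "nat \<Rightarrow> real" and r g :: real
  assumes "is_partition n \<tau>" and "2 \<le> length \<tau>"
    and "\<forall>i<m. A i \<in> carrier_mat n n" and "\<exists>i<m. A i \<noteq> 0\<^sub>m n n"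
    and "W \<in> WW n \<tau>"
    and "inj_on \<gamma> {..<length \<tau>}" and "\<forall>j<length \<tau>. \<bar>\<gamma> j\<bar> \<le> 1"
    and "\<Gamma> = block_scalar_mat \<tau> \<gamma>"
    and "\<forall>i<m. R i = transpose_mat W * A i * W * \<Gamma> - \<Gamma> * (transpose_mat W * A i * W)"
    and "r = sqrt (\<Sum>i<m. (frob_norm (R i))\<^sup>2)"
    and "g = Min {\<bar>\<gamma> j - \<gamma> k\<bar> | j k. j < length \<tau> \<and> k < length \<tau> \<and> j \<noteq> k}"
  shows "\<exists>E :: nat \<Rightarrow> real mat.
     (\<forall>i<m. E i \<in> carrier_mat n n) \<and>
     block_diagonalizer n \<tau> m (\<lambda>i. A i + E i) W \<and>
     family_frob_norm m E / family_frob_norm m A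
       \<le> (spectral_norm (mat_inv W))\<^sup>2 / family_frob_norm m A * (r / g)"
proof -
  have n: "sum_list \<tau> = n" using assms(1) by (simp add: is_partition_def)
  have W: "W \<in> carrier_mat n n" and inv: "invertible_mat W"
    using assms(5) by (auto simp: WW_def)
  define V where "V = mat_inv W"
  have V: "V \<in> carrier_mat n n" and VW: "V * W = 1\<^sub>m n"
    unfolding V_def by (rule mat_inv_invertible[OF W inv])+
  define C where "C i = transpose_mat W * A i * W" for i
  have C: "C i \<in> carrier_mat n n" if "i < m" for i
    using assms(3) that W unfolding C_def by auto
  define D where "D i = Bdiag \<tau> (C i) - C i" for i
  have D: "D i \<in> carrier_mat n n" if "i < m" for i
    using C[OF that] unfolding D_def by auto
  define E where "E i = transpose_mat V * D i * V" for i
  have E: "E i \<in> carrier_mat n n" if "i < m" for i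
    using D[OF that] V unfolding E_def by auto

  let ?G = "{\<bar>\<gamma> j - \<gamma> k\<bar> | j k. j < length \<tau> \<and> k < length \<tau> \<and> j \<noteq> k}"
  have "?G \<subseteq> (\<lambda>(j, k). \<bar>\<gamma> j - \<gamma> k\<bar>) ` ({..<length \<tau>} \<times> {..<length \<tau>})" by auto
  then have fin: "finite ?G" by (rule finite_subset) simp
  have "\<bar>\<gamma> 0 - \<gamma> 1\<bar> \<in> ?G" using assms(2) by fastforce
  then have "g \<in> ?G" unfolding assms(11) using fin by (intro Min_in) auto
  then have g_pos: "0 < g" using assms(6) by (auto simp: inj_on_def)
  have gap: "g \<le> \<bar>\<gamma> j - \<gamma> k\<bar>" if "j < length \<tau>" "k < length \<tau>" "j \<noteq> k" for j k
    unfolding assms(11) using fin that by (intro Min_le) auto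

  have "block_diagonal \<tau> (transpose_mat W * (A i + E i) * W)" if i: "i < m" for i
  proof -
    have Ai: "A i \<in> carrier_mat n n" using assms(3) i by simp
    have "transpose_mat W * (A i + E i) * W = C i + transpose_mat W * E i * W"
      using W Ai E[OF i] unfolding C_def
      by (simp add: mult_add_distrib_mat[of _ n n _ n] add_mult_distrib_mat[of _ n n _ _ n])
    also have "transpose_mat W * E i * W = D i"
      unfolding E_def by (rule congruence_inverse_cancel[OF W V D[OF i] VW])
    also have "C i + D i = Bdiag \<tau> (C i)"
      using C[OF i] Bdiag_carrier[of \<tau> "C i"] unfolding D_def n by (intro eq_matI) auto
    finally show ?thesis by (simp add: block_diagonal_Bdiag)
  qed
  then have diag: "block_diagonalizer n \<tau> m (\<lambda>i. A i + E i) W"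
    using W inv by (simp add: block_diagonalizer_def)

  let ?s = "spectral_norm V"
  have bound: "(frob_norm (E i))\<^sup>2 \<le> (?s\<^sup>2 / g)\<^sup>2 * (frob_norm (R i))\<^sup>2" if i: "i < m" for i
  proof -
    have "g\<^sup>2 * (frob_norm (D i))\<^sup>2 \<le> (frob_norm (R i))\<^sup>2"
      using frob_norm_off_diagonal_le_commutator[of "C i" \<tau> g \<gamma>] C[OF i] g_pos gap assms(8,9) i
      by (simp add: n D_def C_def)
    then have "(frob_norm (D i))\<^sup>2 \<le> (frob_norm (R i))\<^sup>2 / g\<^sup>2"
      using g_pos by (simp add: field_simps)
    then have "?s\<^sup>2 * (?s\<^sup>2 * (frob_norm (D i))\<^sup>2) \<le> ?s\<^sup>2 * (?s\<^sup>2 * ((frob_norm (R i))\<^sup>2 / g\<^sup>2))"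
      by (intro mult_left_mono) auto
    with frob_norm_congruence_le[OF V D[OF i]] show ?thesis
      by (simp add: E_def power_divide power2_eq_square mult.assoc)
  qed
  have "family_frob_norm m E \<le> sqrt ((?s\<^sup>2 / g)\<^sup>2 * (\<Sum>i<m. (frob_norm (R i))\<^sup>2))"
    unfolding family_frob_norm_def sum_distrib_left by (auto intro!: sum_mono bound)
  also have "\<dots> = ?s\<^sup>2 / g * r"
    using g_pos by (simp add: assms(10) real_sqrt_mult)
  finally have "family_frob_norm m E / family_frob_norm m A \<le> ?s\<^sup>2 / g * r / family_frob_norm m A"
    by (rule divide_right_mono) (simp add: family_frob_norm_def sum_nonneg)
  then have "family_frob_norm m E / family_frob_norm m A \<le> ?s\<^sup>2 / family_frob_norm m A * (r / g)"
    by (simp add: mult.commute)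
  with E diag show ?thesis unfolding V_def by blast
qed

end
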